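(* Let $\mathbb{F}$ be a field of characteristic zero, let $\alpha\in\mathbb{F}$, and let $M$ be a subalgebra of $K_3(\alpha)$. Then: (1) if $\dim(M)=1$ and $\alpha=\frac12$, then $M$ is generated by a vector of the form $\gamma_1e+\gamma_2z+\gamma_3w$, where $\gamma_1,\gamma_2,\gamma_3\in\mathbb{F}$; (2) if $\dim(M)=1$ and $\alpha\neq\frac12$, then $M$ is generated by a vector of one of the forms $\gamma_1e+\gamma_2z$ or $\gamma_1e+\gamma_2w$, where $\gamma_1,\gamma_2\in\mathbb{F}$; (3) if $\dim(M)=2$ and $\alpha=\frac12$, then $M$ is generated by a pair of vectors of the form $e$ and $\gamma_1z+\gamma_2w$, where $\gamma_1,\gamma_2\in\mathbb{F}$; (4) if $\dim(M)=2$ and $\alpha\neq\frac12$, then $M$ is generated by one of the following pairs of vectors: $e$ and $z$, or $e$ and $w$.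
   Context: $K_3(\alpha)$ is the superalgebra over $\mathbb{F}$ with even part $\langle e\rangle$, odd part $\langle z,w\rangle$ (so $e,z,w$ is a basis) and multiplication $e^2=e$, $ez=\alpha z$, $ew=(1-\alpha)w$, $ze=(1-\alpha)z$, $we=\alpha w$, $z^2=0$, $zw=2\alpha e$, $wz=-2(1-\alpha)e$, $w^2=0$. A subalgebra is a linear subspace closed under multiplication; it is not required to be spanned by homogeneous elements. *)

theory Defs
  imports "HOL-Analysis.Analysis"
begin

text \<open>
  The superalgebra \<open>K\<^sub>3(\<alpha>)\<close> is realised on coordinate vectors with respect to the
  ordered basis \<open>e, z, w\<close>. Its multiplication \<open>K3_mult \<alpha>\<close> is the bilinear
  extension of the multiplication table checked in \<open>K3_mult_table\<close>.
\<close>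

definition K3_e :: "'f::field ^ 3" where "K3_e = axis 1 1"
definition K3_z :: "'f::field ^ 3" where "K3_z = axis 2 1"
definition K3_w :: "'f::field ^ 3" where "K3_w = axis 3 1"

definition K3_mult :: "'f::field \<Rightarrow> 'f ^ 3 \<Rightarrow> 'f ^ 3 \<Rightarrow> 'f ^ 3" where
  "K3_mult \<alpha> x y = vector
     [x $ 1 * y $ 1 + 2 * \<alpha> * (x $ 2 * y $ 3) - 2 * (1 - \<alpha>) * (x $ 3 * y $ 2),
      \<alpha> * (x $ 1 * y $ 2) + (1 - \<alpha>) * (x $ 2 * y $ 1),
      (1 - \<alpha>) * (x $ 1 * y $ 3) + \<alpha> * (x $ 3 * y $ 1)]"

lemma K3_mult_table:
  "K3_mult \<alpha> K3_e K3_e = K3_e"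
  "K3_mult \<alpha> K3_e K3_z = \<alpha> *s K3_z"
  "K3_mult \<alpha> K3_e K3_w = (1 - \<alpha>) *s K3_w"
  "K3_mult \<alpha> K3_z K3_e = (1 - \<alpha>) *s K3_z"
  "K3_mult \<alpha> K3_w K3_e = \<alpha> *s K3_w"
  "K3_mult \<alpha> K3_z K3_z = 0"
  "K3_mult \<alpha> K3_z K3_w = (2 * \<alpha>) *s K3_e"
  "K3_mult \<alpha> K3_w K3_z = (- 2 * (1 - \<alpha>)) *s K3_e"
  "K3_mult \<alpha> K3_w K3_w = 0"
  by (simp_all add: K3_mult_def K3_e_def K3_z_def K3_w_def vec_eq_iff forall_3 axis_def)

lemma K3_mult_bilinear:
  "K3_mult \<alpha> (x + x') y = K3_mult \<alpha> x y + K3_mult \<alpha> x' y"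
  "K3_mult \<alpha> x (y + y') = K3_mult \<alpha> x y + K3_mult \<alpha> x y'"
  "K3_mult \<alpha> (c *s x) y = c *s K3_mult \<alpha> x y"
  "K3_mult \<alpha> x (c *s y) = c *s K3_mult \<alpha> x y"
  by (simp_all add: K3_mult_def vec_eq_iff forall_3 algebra_simps)

lemma K3_basis_expansion: "x = (x $ 1) *s K3_e + (x $ 2) *s K3_z + (x $ 3) *s K3_w"
  by (simp add: K3_e_def K3_z_def K3_w_def vec_eq_iff forall_3 axis_def)

definition K3_even :: "('f::field ^ 3) set" where "K3_even = vec.span {K3_e}"
definition K3_odd :: "('f::field ^ 3) set" where "K3_odd = vec.span {K3_z, K3_w}"

text \<open>Subalgebras need not be compatible with the grading by \<open>K3_even\<close> and \<open>K3_odd\<close>.\<close>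

definition K3_subalgebra :: "'f::field \<Rightarrow> ('f ^ 3) set \<Rightarrow> bool" where
  "K3_subalgebra \<alpha> M \<longleftrightarrow> vec.subspace M \<and> (\<forall>x\<in>M. \<forall>y\<in>M. K3_mult \<alpha> x y \<in> M)"

definition K3_generated :: "'f::field \<Rightarrow> ('f ^ 3) set \<Rightarrow> ('f ^ 3) set" where
  "K3_generated \<alpha> S = K3_subalgebra \<alpha> hull S"

lemma K3_subalgebra_generated: "K3_subalgebra \<alpha> (K3_generated \<alpha> S)"
  unfolding K3_generated_def
  by (rule hull_in) (auto simp: K3_subalgebra_def intro: vec.subspace_Inter)

end

theory Submission
  imports Defs
begin

text \<open>
  A nonzero \<open>v = (a, b, c)\<close> spans a subalgebra only if \<open>v v = a v + (4\<alpha> - 2) b c e\<close> is a multiple of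
  \<open>v\<close>, i.e. if \<open>(4\<alpha> - 2) b c = 0\<close>. A plane \<open>M\<close> contains an odd \<open>u \<noteq> 0\<close> and some \<open>v\<close> not
  proportional to it, and suitable combinations of \<open>u u\<close>, \<open>u v\<close>, \<open>v u\<close> with \<open>u\<close> are multiples of
  \<open>e\<close>; if they all vanish, \<open>e\<close> is already a combination of \<open>u\<close> and \<open>v\<close>. Hence
  \<open>M = \<langle>e, u\<rangle>\<close>, and closure under \<open>u \<mapsto> e u\<close> forces \<open>u\<close> to be a multiple of \<open>z\<close> or of \<open>w\<close>
  unless \<open>\<alpha> = 1/2\<close>.
\<close>

lemmas K3_coords = K3_e_def K3_z_def K3_w_def vec_eq_iff forall_3 axis_def

lemma K3_subalgebraD:
  assumes "K3_subalgebra \<alpha> M"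
  shows K3_subalgebra_subspace: "vec.subspace M"
    and K3_subalgebra_mult: "x \<in> M \<Longrightarrow> y \<in> M \<Longrightarrow> K3_mult \<alpha> x y \<in> M"
  using assms by (auto simp: K3_subalgebra_def)

text \<open>Every subalgebra containing \<open>S\<close> is a subspace, so it contains the linear
  span of \<open>S\<close>. Generation as an algebra thus reduces to linear spanning.\<close>

lemma K3_generated_eq:
  assumes "K3_subalgebra \<alpha> M" "S \<subseteq> M" "M \<subseteq> vec.span S"
  shows "M = K3_generated \<alpha> S"
proof
  have "S \<subseteq> K3_generated \<alpha> S"
    unfolding K3_generated_def by (rule hull_subset)
  then have "vec.span S \<subseteq> K3_generated \<alpha> S"
    using K3_subalgebra_generated K3_subalgebra_subspace vec.span_minimal by blast
  then show "M \<subseteq> K3_generated \<alpha> S"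
    using assms(3) by blast
  show "K3_generated \<alpha> S \<subseteq> M"
    unfolding K3_generated_def by (rule hull_minimal) (use assms in auto)
qed

lemma subspace_subset_span_if_card_eq_dim:
  fixes M :: "('f::field ^ 'n) set"
  assumes "B \<subseteq> M" "vec.independent B" "finite B" "card B = vec.dim M"
  shows "M \<subseteq> vec.span B"
  using vec.card_ge_dim_independent[of B M] assms by simp

lemma not_subset_span_singleton:
  fixes M :: "('f::field ^ 'n) set"
  assumes "vec.dim M = 2"
  obtains v where "v \<in> M" "\<And>k. v \<noteq> k *s u"
proof -
  have "\<not> M \<subseteq> vec.span {u}"
    using vec.dim_le_card[of M "{u}"] assms by auto
  then obtain v where "v \<in> M" "v \<notin> vec.span {u}" by blast
  then show thesis using that by (auto simp: vec.span_singleton)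
qed

text \<open>A coordinate is a linear functional, so its kernel meets a plane nontrivially. With
  \<open>i = 1\<close> this supplies the odd vector of a two-dimensional subalgebra.\<close>

lemma dim_2_obtain_fst_zero:
  fixes M :: "('f::field ^ 'n) set"
  assumes "vec.subspace M" "vec.dim M = 2"
  obtains u where "u \<in> M" "u \<noteq> 0" "u $ i = 0"
proof -
  obtain x where x: "x \<in> M" "\<And>k. x \<noteq> k *s 0"
    using not_subset_span_singleton[OF assms(2), of 0] by blast
  obtain y where y: "y \<in> M" "\<And>k. y \<noteq> k *s x"
    using not_subset_span_singleton[OF assms(2), of x] by blast
  show thesis
  proof (cases "x $ i = 0")
    case True
    then show thesis using that[of x] x by simp
  next
    case False
    let ?u = "y - (y $ i / x $ i) *s x"
    have "?u \<in> M" by (intro vec.subspace_diff vec.subspace_scale assms x y)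
    moreover have "?u \<noteq> 0" using y by simp
    moreover have "?u $ i = 0" using False by simp
    ultimately show thesis using that by blast
  qed
qed

lemma K3_e_memI:
  assumes "vec.subspace M" "x \<in> M" "x $ 1 \<noteq> 0" "x $ 2 = 0" "x $ 3 = 0"
  shows "K3_e \<in> M"
proof -
  have "K3_e = (1 / x $ 1) *s x" using assms by (simp add: K3_coords)
  then show ?thesis using assms vec.subspace_scale by metis
qed

lemma K3_z_memI:
  assumes "vec.subspace M" "x \<in> M" "x $ 1 = 0" "x $ 2 \<noteq> 0" "x $ 3 = 0"
  shows "K3_z \<in> M"
proof -
  have "K3_z = (1 / x $ 2) *s x" using assms by (simp add: K3_coords)
  then show ?thesis using assms vec.subspace_scale by metis
qed

lemma K3_w_memI:
  assumes "vec.subspace M" "x \<in> M" "x $ 1 = 0" "x $ 2 = 0" "x $ 3 \<noteq> 0"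
  shows "K3_w \<in> M"
proof -
  have "K3_w = (1 / x $ 3) *s x" using assms by (simp add: K3_coords)
  then show ?thesis using assms vec.subspace_scale by metis
qed

text \<open>Only the odd parts are compared: \<open>v $ 1\<close> stays free, so \<open>v\<close>
  agrees with \<open>k *s u\<close> up to a multiple of \<open>K3_e\<close>.\<close>

lemma proportional_if_minor_eq_0:
  fixes u v :: "'f::field ^ 3"
  assumes "u \<noteq> 0" "u $ 1 = 0" "u $ 2 * v $ 3 = u $ 3 * v $ 2"
  obtains k where "v $ 2 = k * u $ 2" "v $ 3 = k * u $ 3"
proof (cases "u $ 2 = 0")
  case True
  then have "u $ 3 \<noteq> 0" using assms by (auto simp: vec_eq_iff forall_3)
  then show thesis using that[of "v $ 3 / u $ 3"] True assms by auto
next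
  case False
  then show thesis using that[of "v $ 2 / u $ 2"] assms by (auto simp: field_simps)
qed

lemma K3_e_mem_if_dim_2:
  fixes \<alpha> :: "'f::field_char_0"
  assumes M: "K3_subalgebra \<alpha> M" and u: "u \<in> M" "u \<noteq> 0" "u $ 1 = 0" and "vec.dim M = 2"
  shows "K3_e \<in> M"
proof (rule ccontr)
  note sub = K3_subalgebra_subspace[OF M] and mult = K3_subalgebra_mult[OF M]
  assume "K3_e \<notin> M"
  then have nomem: "x $ 1 = 0" if "x \<in> M" "x $ 2 = 0" "x $ 3 = 0" for x
    using K3_e_memI[OF sub] that by blast
  obtain v where v: "v \<in> M" "\<And>k. v \<noteq> k *s u"
    using not_subset_span_singleton[OF assms(5), of u] by blast
  \<comment> \<open>A vanishing minor would make \<open>v - k *s u\<close> a multiple of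
    \<open>K3_e\<close> lying in \<open>M\<close>, hence zero, against the choice of
    \<open>v\<close>.\<close>
  have nprop: False if minor: "u $ 2 * v $ 3 = u $ 3 * v $ 2"
  proof -
    obtain k where k: "v $ 2 = k * u $ 2" "v $ 3 = k * u $ 3"
      using proportional_if_minor_eq_0[OF u(2,3) minor] .
    have "v - k *s u \<in> M" by (intro vec.subspace_diff vec.subspace_scale sub u v)
    then have "v $ 1 = 0" using nomem[of "v - k *s u"] k u by simp
    then show False using v(2)[of k] k u by (simp add: vec_eq_iff forall_3)
  qed
  show False
  proof (cases "v $ 1 = 0 \<or> \<alpha> = 1 / 2")
    case True
    \<comment> \<open>The odd coordinates of the commutator are, up to sign,
      \<open>(1 - 2 * \<alpha>) * v $ 1\<close> times those of \<open>u\<close>, so they vanish in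
      this case. Its even coordinate is twice the minor.\<close>
    let ?x = "K3_mult \<alpha> u v - K3_mult \<alpha> v u"
    have "?x \<in> M" by (intro vec.subspace_diff mult sub u v)
    moreover have "?x $ 2 = 0" "?x $ 3 = 0"
      using True u by (auto simp: K3_mult_def algebra_simps)
    moreover have "?x $ 1 = 2 * (u $ 2 * v $ 3 - u $ 3 * v $ 2)"
      using u by (simp add: K3_mult_def algebra_simps)
    ultimately show False using nomem[of ?x] nprop by simp
  next
    case False
    then have \<alpha>: "4 * \<alpha> - 2 \<noteq> 0" by (auto simp: field_simps)
    have "K3_mult \<alpha> u u $ 1 = (4 * \<alpha> - 2) * (u $ 2 * u $ 3)"
      "K3_mult \<alpha> u u $ 2 = 0" "K3_mult \<alpha> u u $ 3 = 0"
      using u by (simp_all add: K3_mult_def algebra_simps)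
    with nomem[OF mult[OF u(1) u(1)]] \<alpha> have uu: "u $ 2 * u $ 3 = 0" by simp
    \<comment> \<open>Since \<alpha> and 1 - \<alpha> add up to 1, the anticommutator has odd part
      \<open>v $ 1 *s u\<close>; subtracting it leaves a multiple of \<open>K3_e\<close>.\<close>
    let ?x = "K3_mult \<alpha> u v + K3_mult \<alpha> v u - v $ 1 *s u"
    have "?x \<in> M" by (intro vec.subspace_diff vec.subspace_add vec.subspace_scale mult sub u v)
    moreover have "?x $ 2 = 0" "?x $ 3 = 0"
      using u by (auto simp: K3_mult_def algebra_simps)
    moreover have "?x $ 1 = (4 * \<alpha> - 2) * (u $ 2 * v $ 3 + u $ 3 * v $ 2)"
      using u by (simp add: K3_mult_def algebra_simps)
    ultimately have "u $ 2 * v $ 3 + u $ 3 * v $ 2 = 0"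
      using nomem[of ?x] \<alpha> by simp
    \<comment> \<open>By \<open>uu\<close> one coordinate of \<open>u\<close> is zero, which kills
      one product in the sum; the other is then zero as well, and so is the minor.\<close>
    with uu nprop show False by auto
  qed
qed

text \<open>A nonzero odd vector is independent of \<open>K3_e\<close>, so the two already span the
  plane.\<close>

lemma K3_generated_pair:
  assumes M: "K3_subalgebra \<alpha> M" "vec.dim M = 2"
    and u: "K3_e \<in> M" "u \<in> M" "u \<noteq> 0" "u $ 1 = 0"
  shows "M = K3_generated \<alpha> {K3_e, u}"
proof (rule K3_generated_eq)
  have "K3_e \<notin> vec.span {u}"
    using u(4) by (auto simp: vec.span_singleton K3_coords)
  moreover from this have "K3_e \<noteq> u"
    using vec.span_base by auto
  ultimately show "M \<subseteq> vec.span {K3_e, u}"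
    using u M(2) by (intro subspace_subset_span_if_card_eq_dim) (auto simp: vec.independent_insert)
qed (use assms in auto)

text \<open>The coefficients \<alpha> and 1 - \<alpha> add up to 1 on the odd part, and the products
  zw and wz contribute 2\<alpha> - 2(1 - \<alpha>).\<close>

lemma K3_mult_self:
  "K3_mult \<alpha> x x = x $ 1 *s x + ((4 * \<alpha> - 2) * (x $ 2 * x $ 3)) *s K3_e"
  by (simp add: K3_mult_def K3_coords algebra_simps)

lemma K3_dim_1:
  fixes \<alpha> :: "'f::field_char_0"
  assumes M: "K3_subalgebra \<alpha> M" "vec.dim M = 1"
  obtains v where "M = K3_generated \<alpha> {v}" "\<alpha> = 1 / 2 \<or> v $ 2 = 0 \<or> v $ 3 = 0"
proof -
  note sub = K3_subalgebra_subspace[OF M(1)] and mult = K3_subalgebra_mult[OF M(1)]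
  obtain B where B: "B \<subseteq> M" "M \<subseteq> vec.span B" "card B = 1"
    using vec.basis_exists[of M] M(2) by metis
  then obtain v where v: "v \<in> M" "M \<subseteq> vec.span {v}"
    by (auto simp: card_1_singleton_iff)
  have "\<alpha> = 1 / 2 \<or> v $ 2 = 0 \<or> v $ 3 = 0"
  proof -
    let ?c = "(4 * \<alpha> - 2) * (v $ 2 * v $ 3)"
    have "K3_mult \<alpha> v v - v $ 1 *s v \<in> M"
      by (intro vec.subspace_diff vec.subspace_scale mult sub v)
    then obtain k where "?c *s K3_e = k *s v"
      using v(2) by (auto simp: K3_mult_self vec.span_singleton)
    then have "?c = k * v $ 1" "0 = k * v $ 2"
      by (simp_all add: K3_coords)
    \<comment> \<open>Either \<open>k = 0\<close>, or \<open>v $ 2 = 0\<close>, which is a factor of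
      \<open>?c\<close>.\<close>
    then have "?c = 0" by auto
    then show ?thesis by (auto simp: field_simps)
  qed
  with that K3_generated_eq[OF M(1) _ v(2)] v(1) show thesis by blast
qed

theorem theorem5:
  fixes \<alpha> :: "'f::field_char_0" and M :: "('f ^ 3) set"
  assumes "K3_subalgebra \<alpha> M"
  shows
    "(vec.dim M = 1 \<and> \<alpha> = 1 / 2 \<longrightarrow>
        (\<exists>\<gamma>\<^sub>1 \<gamma>\<^sub>2 \<gamma>\<^sub>3. M = K3_generated \<alpha> {\<gamma>\<^sub>1 *s K3_e + \<gamma>\<^sub>2 *s K3_z + \<gamma>\<^sub>3 *s K3_w})) \<and>
     (vec.dim M = 1 \<and> \<alpha> \<noteq> 1 / 2 \<longrightarrow>
        (\<exists>\<gamma>\<^sub>1 \<gamma>\<^sub>2. M = K3_generated \<alpha> {\<gamma>\<^sub>1 *s K3_e + \<gamma>\<^sub>2 *s K3_z}) \<or>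
        (\<exists>\<gamma>\<^sub>1 \<gamma>\<^sub>2. M = K3_generated \<alpha> {\<gamma>\<^sub>1 *s K3_e + \<gamma>\<^sub>2 *s K3_w})) \<and>
     (vec.dim M = 2 \<and> \<alpha> = 1 / 2 \<longrightarrow>
        (\<exists>\<gamma>\<^sub>1 \<gamma>\<^sub>2. M = K3_generated \<alpha> {K3_e, \<gamma>\<^sub>1 *s K3_z + \<gamma>\<^sub>2 *s K3_w})) \<and>
     (vec.dim M = 2 \<and> \<alpha> \<noteq> 1 / 2 \<longrightarrow>
        M = K3_generated \<alpha> {K3_e, K3_z} \<or> M = K3_generated \<alpha> {K3_e, K3_w})"
proof (intro conjI impI; elim conjE)
  assume "vec.dim M = 1"
  then obtain v where "M = K3_generated \<alpha> {v}" using K3_dim_1[OF assms] by blast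
  then show "\<exists>\<gamma>\<^sub>1 \<gamma>\<^sub>2 \<gamma>\<^sub>3. M = K3_generated \<alpha> {\<gamma>\<^sub>1 *s K3_e + \<gamma>\<^sub>2 *s K3_z + \<gamma>\<^sub>3 *s K3_w}"
    using K3_basis_expansion[of v] by metis
next
  assume "vec.dim M = 1" "\<alpha> \<noteq> 1 / 2"
  then obtain v where v: "M = K3_generated \<alpha> {v}" "v $ 2 = 0 \<or> v $ 3 = 0"
    using K3_dim_1[OF assms] by metis
  from v(2) have "v = v $ 1 *s K3_e + v $ 2 *s K3_z \<or> v = v $ 1 *s K3_e + v $ 3 *s K3_w"
    by (auto simp: K3_coords)
  with v(1) show "(\<exists>\<gamma>\<^sub>1 \<gamma>\<^sub>2. M = K3_generated \<alpha> {\<gamma>\<^sub>1 *s K3_e + \<gamma>\<^sub>2 *s K3_z}) \<or>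
      (\<exists>\<gamma>\<^sub>1 \<gamma>\<^sub>2. M = K3_generated \<alpha> {\<gamma>\<^sub>1 *s K3_e + \<gamma>\<^sub>2 *s K3_w})"
    by metis
next
  assume dim: "vec.dim M = 2"
  obtain u where u: "u \<in> M" "u \<noteq> 0" "u $ 1 = 0"
    using dim_2_obtain_fst_zero[OF K3_subalgebra_subspace[OF assms] dim] .
  have "M = K3_generated \<alpha> {K3_e, u}"
    using K3_generated_pair[OF assms dim K3_e_mem_if_dim_2[OF assms u dim] u] .
  moreover have "u = u $ 2 *s K3_z + u $ 3 *s K3_w"
    using u(3) by (simp add: K3_coords)
  ultimately show "\<exists>\<gamma>\<^sub>1 \<gamma>\<^sub>2. M = K3_generated \<alpha> {K3_e, \<gamma>\<^sub>1 *s K3_z + \<gamma>\<^sub>2 *s K3_w}"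
    by metis
next
  assume dim: "vec.dim M = 2" and \<alpha>: "\<alpha> \<noteq> 1 / 2"
  note sub = K3_subalgebra_subspace[OF assms] and mult = K3_subalgebra_mult[OF assms]
  obtain u where u: "u \<in> M" "u \<noteq> 0" "u $ 1 = 0"
    using dim_2_obtain_fst_zero[OF sub dim] .
  have e: "K3_e \<in> M" using K3_e_mem_if_dim_2[OF assms u dim] .
  have "K3_z \<in> M \<or> K3_w \<in> M"
  proof (cases "u $ 3 = 0")
    case True
    then have "u $ 2 \<noteq> 0" using u by (auto simp: vec_eq_iff forall_3)
    with True u show ?thesis using K3_z_memI[OF sub] by blast
  next
    case False
    \<comment> \<open>Left multiplication by \<open>K3_e\<close> has eigenvalue \<alpha> on
      \<open>K3_z\<close> and 1 - \<alpha> on \<open>K3_w\<close>. Subtracting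
      \<open>\<alpha> *s u\<close> removes the \<open>K3_z\<close> component; the other survives
      because the eigenvalues differ.\<close>
    let ?x = "K3_mult \<alpha> K3_e u - \<alpha> *s u"
    have "?x \<in> M" by (intro vec.subspace_diff vec.subspace_scale mult sub u e)
    moreover have "?x $ 1 = 0" "?x $ 2 = 0"
      using u by (simp_all add: K3_mult_def K3_e_def axis_def)
    moreover have "?x $ 3 = (1 - 2 * \<alpha>) * u $ 3"
      by (simp add: K3_mult_def K3_e_def axis_def algebra_simps)
    then have "?x $ 3 \<noteq> 0" using False \<alpha> by (auto simp: field_simps)
    ultimately show ?thesis using K3_w_memI[OF sub] by blast
  qed
  moreover have "K3_z \<noteq> 0" "K3_z $ 1 = 0" "K3_w \<noteq> 0" "K3_w $ 1 = 0"
    by (simp_all add: K3_coords)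
  ultimately show "M = K3_generated \<alpha> {K3_e, K3_z} \<or> M = K3_generated \<alpha> {K3_e, K3_w}"
    using K3_generated_pair[OF assms dim e] by blast
qed

end
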